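(* Let $(\Sigma,\sigma)$ be a transitive countable Markov shift, with compactification $(\bar\Sigma,\bar\sigma)$. Let $(\mu_n)_n$ be a sequence in $\mathcal{M}(\Sigma,\sigma)$ and let $\mu\in\mathcal{M}(\Sigma,\sigma)$. Then: (a) If $(\mu_n)_n$ converges on cylinders to $\lambda\mu$ for some $\lambda\in[0,1)$, then $(\mu_n)_n$ converges in the weak$^*$ topology of $\mathcal{M}(\bar\Sigma,\bar\sigma)$ to the measure $\lambda\mu+(1-\lambda)\delta_{\bar\infty}$. (b) If $\bar\infty\in\bar\Sigma$ and $(\mu_n)_n$ converges in the weak$^*$ topology of $\mathcal{M}(\bar\Sigma,\bar\sigma)$ to the measure $\lambda\mu+(1-\lambda)\delta_{\bar\infty}$, where $\lambda\in[0,1]$, then $(\mu_n)_n$ converges on cylinders to $\lambda\mu$.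
   Context: Countable Markov shift: let $M$ be an $\mathbb{N}\times\mathbb{N}$ matrix with entries in $\{0,1\}$, $\mathbb{N}=\{1,2,\dots\}$; $\Sigma=\{(x_1,x_2,\dots)\in\mathbb{N}^{\mathbb{N}}: M(x_i,x_{i+1})=1\ \forall i\in\mathbb{N}\}$ with the topology induced by the product of discrete topologies, and $\sigma(x_1,x_2,\dots)=(x_2,x_3,\dots)$. An admissible word is a finite string $a_1\dots a_N$ in $\mathbb{N}$ with $M(a_i,a_{i+1})=1$ for $1\le i<N$. The shift is transitive if for all $a,b\in\mathbb{N}$ there is an admissible word starting with $a$ and ending with $b$ (in particular $\Sigma$ is non-compact). $\mathcal{M}(\Sigma,\sigma)$ is the set of $\sigma$-invariant Borel probability measures on $\Sigma$. A cylinder of $\Sigma$ is a set $[a_1,\dots,a_N]=\{x\in\Sigma:x_i=a_i,\ 1\le i\le N\}$ with $a_i\in\mathbb{N}$. A sequence $(\mu_n)_n$ of $\sigma$-invariant sub-probability measures converges on cylinders to a $\sigma$-invariant Borel sub-probability measure $m$ on $\Sigma$ if $\mu_n(C)\to m(C)$ for every cylinder $C\subseteq\Sigma$. Compactification: equip $\mathbb{N}\cup\{\infty\}$ with the metric $\bar\rho(a,b)=|1/a-1/b|$ (with $1/\infty=0$) and $(\mathbb{N}\cup\{\infty\})^{\mathbb{N}}$ with $\bar d_\rho(x,y)=\sum_{n\in\mathbb{N}}2^{-n}\bar\rho(x_n,y_n)$ (a compact metric space). $\bar\Sigma$ is the closure of $\Sigma$ in this space, and $\bar\sigma:\bar\Sigma\to\bar\Sigma$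 is the left shift, the continuous extension of $\sigma$. $\mathcal{M}(\bar\Sigma,\bar\sigma)$ is the space of $\bar\sigma$-invariant Borel probability measures on $\bar\Sigma$ with the weak$^*$ topology, and $\mathcal{M}(\Sigma,\sigma)$ is identified with $\{\mu\in\mathcal{M}(\bar\Sigma,\bar\sigma):\mu(\Sigma)=1\}$. $\bar\infty=(\infty,\infty,\dots)$ and $\delta_{\bar\infty}$ is the Dirac measure at $\bar\infty$ (an element of $\mathcal{M}(\bar\Sigma,\bar\sigma)$ when $\bar\infty\in\bar\Sigma$). *)

theory Defs
  imports "HOL-Probability.Probability"
begin

text \<open>
  The alphabet \<open>{1, 2, \<dots>}\<close> is the set of positive elements of \<^typ>\<open>nat\<close>, and its
  compactification \<open>{1, 2, \<dots>} \<union> {\<infinity>}\<close> is the set of positive elements of \<^typ>\<open>enat\<close>.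
  Sequences are indexed from 0, so \<open>x i\<close> stands for \<open>x\<^sub>i\<^sub>+\<^sub>1\<close>.
\<close>

definition shift :: "(nat \<Rightarrow> 'a) \<Rightarrow> nat \<Rightarrow> 'a" where
  "shift x = (\<lambda>i. x (Suc i))"

definition borel_of :: "'a topology \<Rightarrow> 'a measure" where
  "borel_of X = sigma (topspace X) {U. openin X U}"

definition shift_invariant :: "(nat \<Rightarrow> 'a) measure \<Rightarrow> bool" where
  "shift_invariant \<mu> \<longleftrightarrow>
     (\<forall>A\<in>sets \<mu>. emeasure \<mu> (shift -` A \<inter> space \<mu>) = emeasure \<mu> A)"

definition add_measure :: "'a measure \<Rightarrow> 'a measure \<Rightarrow> 'a measure" where
  "add_measure \<mu> \<nu> =
     measure_of (space \<mu>) (sets \<mu>) (\<lambda>A. emeasure \<mu> A + emeasure \<nu> A)"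


section \<open>Countable Markov shifts\<close>

definition transition_matrix :: "(nat \<Rightarrow> nat \<Rightarrow> nat) \<Rightarrow> bool" where
  "transition_matrix M \<longleftrightarrow> (\<forall>a\<ge>1. \<forall>b\<ge>1. M a b \<in> {0, 1})"

definition markov_shift :: "(nat \<Rightarrow> nat \<Rightarrow> nat) \<Rightarrow> (nat \<Rightarrow> nat) set" where
  "markov_shift M = {x. (\<forall>i. 1 \<le> x i) \<and> (\<forall>i. M (x i) (x (Suc i)) = 1)}"

definition markov_topology :: "(nat \<Rightarrow> nat \<Rightarrow> nat) \<Rightarrow> (nat \<Rightarrow> nat) topology" where
  "markov_topology M =
     subtopology (product_topology (\<lambda>_. discrete_topology {1..}) UNIV) (markov_shift M)"

definition admissible_word :: "(nat \<Rightarrow> nat \<Rightarrow> nat) \<Rightarrow> nat list \<Rightarrow> bool" where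
  "admissible_word M w \<longleftrightarrow>
     w \<noteq> [] \<and> (\<forall>a\<in>set w. 1 \<le> a) \<and> (\<forall>i. Suc i < length w \<longrightarrow> M (w ! i) (w ! Suc i) = 1)"

definition transitive_shift :: "(nat \<Rightarrow> nat \<Rightarrow> nat) \<Rightarrow> bool" where
  "transitive_shift M \<longleftrightarrow>
     (\<forall>a\<ge>1. \<forall>b\<ge>1. \<exists>w. admissible_word M w \<and> hd w = a \<and> last w = b)"

definition invariant_prob :: "(nat \<Rightarrow> nat \<Rightarrow> nat) \<Rightarrow> (nat \<Rightarrow> nat) measure set" where
  "invariant_prob M =
     {\<mu>. sets \<mu> = sets (borel_of (markov_topology M)) \<and> prob_space \<mu> \<and> shift_invariant \<mu>}"

definition invariant_subprob :: "(nat \<Rightarrow> nat \<Rightarrow> nat) \<Rightarrow> (nat \<Rightarrow> nat) measure set" where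
  "invariant_subprob M =
     {\<mu>. sets \<mu> = sets (borel_of (markov_topology M)) \<and> subprob_space \<mu> \<and> shift_invariant \<mu>}"

definition cylinder :: "(nat \<Rightarrow> nat \<Rightarrow> nat) \<Rightarrow> nat list \<Rightarrow> (nat \<Rightarrow> nat) set" where
  "cylinder M w = {x \<in> markov_shift M. \<forall>i<length w. x i = w ! i}"

text \<open>
  The empty word is excluded: it would give the whole space as a cylinder and thereby
  force convergence of the total masses.
\<close>

definition cylinders :: "(nat \<Rightarrow> nat \<Rightarrow> nat) \<Rightarrow> (nat \<Rightarrow> nat) set set" where
  "cylinders M = {cylinder M w | w. w \<noteq> [] \<and> (\<forall>a\<in>set w. 1 \<le> a)}"

definition converges_on_cylinders ::
  "(nat \<Rightarrow> nat \<Rightarrow> nat) \<Rightarrow> (nat \<Rightarrow> (nat \<Rightarrow> nat) measure) \<Rightarrow> (nat \<Rightarrow> nat) measure \<Rightarrow> bool" where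
  "converges_on_cylinders M \<mu>s m \<longleftrightarrow>
     (\<forall>n. \<mu>s n \<in> invariant_subprob M) \<and> m \<in> invariant_subprob M \<and>
     (\<forall>C\<in>cylinders M. (\<lambda>n. measure (\<mu>s n) C) \<longlonglongrightarrow> measure m C)"


section \<open>The compactification\<close>

definition recip :: "enat \<Rightarrow> real" where
  "recip a = (case a of enat n \<Rightarrow> 1 / real n | \<infinity> \<Rightarrow> 0)"

definition rho_bar :: "enat \<Rightarrow> enat \<Rightarrow> real" where
  "rho_bar a b = \<bar>recip a - recip b\<bar>"

definition ext_sequences :: "(nat \<Rightarrow> enat) set" where
  "ext_sequences = {x. \<forall>i. 1 \<le> x i}"

definition d_bar :: "(nat \<Rightarrow> enat) \<Rightarrow> (nat \<Rightarrow> enat) \<Rightarrow> real" where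
  "d_bar x y = (\<Sum>i. (1 / 2) ^ Suc i * rho_bar (x i) (y i))"

lemma recip_bounds: "0 \<le> recip a" "recip a \<le> 1"
  by (auto simp: recip_def divide_le_eq split: enat.split)

lemma recip_inj: "1 \<le> a \<Longrightarrow> 1 \<le> b \<Longrightarrow> recip a = recip b \<longleftrightarrow> a = b"
  by (cases a; cases b) (auto simp: recip_def one_enat_def)

lemma summable_d_bar: "summable (\<lambda>i. (1 / 2) ^ Suc i * rho_bar (x i) (y i))"
proof (rule summable_comparison_test')
  show "summable (\<lambda>i. (1 / 2 :: real) ^ Suc i)"
    by (intro summable_Suc_iff[THEN iffD2] summable_geometric) simp
  have "rho_bar (x i) (y i) \<le> 1" for i
    using recip_bounds[of "x i"] recip_bounds[of "y i"] by (simp add: rho_bar_def)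
  then show "norm ((1 / 2) ^ Suc i * rho_bar (x i) (y i)) \<le> (1 / 2) ^ Suc i" for i
    by (simp add: abs_mult rho_bar_def mult_left_le)
qed

interpretation ext: Metric_space ext_sequences d_bar
proof
  show "0 \<le> d_bar x y" for x y
    unfolding d_bar_def by (intro suminf_nonneg summable_d_bar) (simp add: rho_bar_def)
  show "d_bar x y = d_bar y x" for x y
    by (simp add: d_bar_def rho_bar_def abs_minus_commute)
  show "d_bar x y = 0 \<longleftrightarrow> x = y" if "x \<in> ext_sequences" "y \<in> ext_sequences" for x y
  proof -
    have "d_bar x y = 0 \<longleftrightarrow> (\<forall>i. (1 / 2) ^ Suc i * rho_bar (x i) (y i) = 0)"
      unfolding d_bar_def by (intro suminf_eq_zero_iff summable_d_bar) (simp add: rho_bar_def)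
    then show ?thesis
      using that by (auto simp: rho_bar_def ext_sequences_def recip_inj fun_eq_iff)
  qed
  show "d_bar x z \<le> d_bar x y + d_bar y z" for x y z
    unfolding d_bar_def suminf_add[OF summable_d_bar summable_d_bar]
    by (intro suminf_le summable_add summable_d_bar)
       (simp add: rho_bar_def flip: distrib_left)
qed

definition incl :: "(nat \<Rightarrow> nat) \<Rightarrow> nat \<Rightarrow> enat" where
  "incl x = (\<lambda>i. enat (x i))"

definition compactification :: "(nat \<Rightarrow> nat \<Rightarrow> nat) \<Rightarrow> (nat \<Rightarrow> enat) set" where
  "compactification M = ext.mtopology closure_of (incl ` markov_shift M)"

definition compact_topology :: "(nat \<Rightarrow> nat \<Rightarrow> nat) \<Rightarrow> (nat \<Rightarrow> enat) topology" where
  "compact_topology M = subtopology ext.mtopology (compactification M)"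

definition compact_invariant_prob :: "(nat \<Rightarrow> nat \<Rightarrow> nat) \<Rightarrow> (nat \<Rightarrow> enat) measure set" where
  "compact_invariant_prob M =
     {\<mu>. sets \<mu> = sets (borel_of (compact_topology M)) \<and> prob_space \<mu> \<and> shift_invariant \<mu>}"

text \<open>
  The weak* topology is the coarsest topology on the invariant probability measures for which
  \<open>\<mu> \<mapsto> \<integral> f d\<mu>\<close> is continuous for every continuous real function \<open>f\<close>.
\<close>

definition weak_star_topology :: "(nat \<Rightarrow> nat \<Rightarrow> nat) \<Rightarrow> (nat \<Rightarrow> enat) measure topology" where
  "weak_star_topology M = topology_generated_by
     {{\<mu> \<in> compact_invariant_prob M. (\<integral>x. f x \<partial>\<mu>) \<in> U} | f U.
        continuous_map (compact_topology M) euclideanreal f \<and> open U}"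

lemma topspace_weak_star: "topspace (weak_star_topology M) = compact_invariant_prob M"
proof -
  have "compact_invariant_prob M \<in> {{\<mu> \<in> compact_invariant_prob M. (\<integral>x. f x \<partial>\<mu>) \<in> U} | f U.
        continuous_map (compact_topology M) euclideanreal f \<and> open U}"
    by (rule CollectI, rule exI[of _ "\<lambda>_. 0"], rule exI[of _ UNIV]) auto
  then show ?thesis
    unfolding weak_star_topology_def topology_generated_by_topspace by blast
qed

text \<open>
  The push-forward along \<open>incl\<close> realises the identification of the invariant probability
  measures on the Markov shift with those on the compactification that give the shift full mass.
\<close>

definition extend_measure_to :: "(nat \<Rightarrow> nat \<Rightarrow> nat) \<Rightarrow> (nat \<Rightarrow> nat) measure \<Rightarrow> (nat \<Rightarrow> enat) measure"
  where "extend_measure_to M \<mu> = distr \<mu> (borel_of (compact_topology M)) incl"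

definition infinity_seq :: "nat \<Rightarrow> enat" where
  "infinity_seq = (\<lambda>_. \<infinity>)"

definition mix_with_infinity ::
  "(nat \<Rightarrow> nat \<Rightarrow> nat) \<Rightarrow> real \<Rightarrow> (nat \<Rightarrow> nat) measure \<Rightarrow> (nat \<Rightarrow> enat) measure" where
  "mix_with_infinity M c \<mu> = add_measure
     (scale_measure (ennreal c) (extend_measure_to M \<mu>))
     (scale_measure (ennreal (1 - c)) (return (borel_of (compact_topology M)) infinity_seq))"

end

theory Submission
  imports Defs
begin

text \<open>
  Suppose first that the \<open>\<mu>s n\<close> converge on cylinders to \<open>\<nu> = c \<mu>\<close> with \<open>c < 1\<close>.  An open subset
  \<open>U\<close> of the Markov shift is a countable disjoint union of cylinders, so Fatou's lemma gives
  \<open>liminf \<mu>s n U \<ge> \<nu> U\<close> (\<open>liminf_openin\<close>).  Upper bounds hold as well for the sets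
  \<open>E = {x. \<exists>i<N. x i \<le> k}\<close>: by invariance the mass of \<open>{x. x i = a}\<close> is that of the cylinder
  \<open>[a]\<close> and hence converges, and convergence passes to finite unions because
  \<open>m (A \<union> B) = m A + m B - m (A \<inter> B)\<close> and the last term is lower semicontinuous
  (\<open>tendsto_measure_finite_Union\<close>).  So \<open>\<mu>s n E\<close> converges to \<open>\<nu> E \<le> c < 1\<close>.

  The complements of the sets \<open>E\<close> are the traces of a neighbourhood base of
  \<open>infinity_seq\<close>.  They are therefore nonempty, which puts \<open>infinity_seq\<close> into the
  compactification, and they absorb the missing mass \<open>1 - c\<close>.  It follows that
  \<open>liminf P n V \<ge> P V\<close> for every open subset \<open>V\<close> of the compactification, where \<open>P n\<close> extends
  \<open>\<mu>s n\<close> and \<open>P\<close> is the mixture of \<open>\<mu>\<close> with the Dirac measure at \<open>infinity_seq\<close>.  By the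
  portmanteau argument (\<open>portmanteau_compact\<close>), this is weak* convergence.

  Conversely, the points of the compactification that begin with a given nonempty finite word
  form a set that is open and closed and does not contain \<open>infinity_seq\<close>.  Its indicator
  is a continuous test function, and integrating it gives the convergence on that cylinder.
\<close>

section \<open>The topology of the Markov shift\<close>

text \<open>The cylinders form a base of the topology.\<close>

lemma openin_markov_iff:
  "openin (markov_topology M) U \<longleftrightarrow>
     U \<subseteq> markov_shift M \<and>
     (\<forall>x\<in>U. \<exists>N. \<forall>y\<in>markov_shift M. (\<forall>i<N. y i = x i) \<longrightarrow> y \<in> U)"
  (is "_ \<longleftrightarrow> ?R")
proof
  let ?P = "product_topology (\<lambda>_::nat. discrete_topology {1::nat..}) UNIV"
  assume "openin (markov_topology M) U"
  then obtain V where V: "openin ?P V" "U = V \<inter> markov_shift M"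
    by (auto simp: markov_topology_def openin_subtopology)
  have "\<exists>N. \<forall>y\<in>markov_shift M. (\<forall>i<N. y i = x i) \<longrightarrow> y \<in> U" if "x \<in> U" for x
  proof -
    have "x \<in> V" using V(2) that by blast
    from bspec[OF V(1)[unfolded openin_product_topology_alt] this]
    obtain W where "finite {i \<in> UNIV. W i \<noteq> topspace (discrete_topology {1::nat..})}"
      and W: "x \<in> PiE UNIV W" "PiE UNIV W \<subseteq> V"
      by blast
    then have fin: "finite {i. W i \<noteq> {1..}}" by simp
    obtain N where N: "\<And>i. W i \<noteq> {1..} \<Longrightarrow> i < N"
      using fin unfolding finite_nat_set_iff_bounded by auto
    have "y \<in> U" if y: "y \<in> markov_shift M" "\<forall>i<N. y i = x i" for y
    proof -
      have "y i \<in> W i" for i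
        using N[of i] W(1) y by (cases "i < N") (auto simp: markov_shift_def PiE_iff)
      then show ?thesis using W(2) V(2) y(1) by (auto simp: PiE_iff)
    qed
    then show ?thesis by blast
  qed
  then show ?R using V(2) by blast
next
  let ?P = "product_topology (\<lambda>_::nat. discrete_topology {1::nat..}) UNIV"
  assume R: ?R
  then obtain N where N: "\<And>x y. x \<in> U \<Longrightarrow> y \<in> markov_shift M \<Longrightarrow> \<forall>i<N x. y i = x i \<Longrightarrow> y \<in> U"
    by metis
  define W where "W x = PiE UNIV (\<lambda>i. if i < N x then {x i} else {1::nat..})" for x
  have "openin ?P (W x)" if "x \<in> U" for x
  proof -
    have "x i \<ge> 1" for i using R that by (auto simp: markov_shift_def)
    moreover have "finite {i. (if i < N x then {x i} else {1..}) \<noteq> {1::nat..}}"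
      by (rule finite_subset[of _ "{..<N x}"]) auto
    ultimately show ?thesis
      unfolding W_def by (subst openin_PiE_gen) auto
  qed
  then have "openin ?P (\<Union>x\<in>U. W x)" by blast
  moreover have "U = (\<Union>x\<in>U. W x) \<inter> markov_shift M"
  proof (intro equalityI subsetI)
    fix x assume "x \<in> U"
    moreover from this R have "x \<in> markov_shift M" "x \<in> W x"
      by (auto simp: W_def markov_shift_def)
    ultimately show "x \<in> (\<Union>x\<in>U. W x) \<inter> markov_shift M" by blast
  next
    fix y assume "y \<in> (\<Union>x\<in>U. W x) \<inter> markov_shift M"
    then obtain x where x: "x \<in> U" "y \<in> W x" "y \<in> markov_shift M" by blast
    have "y i = x i" if "i < N x" for i
      using PiE_mem[OF x(2)[unfolded W_def], of i] that by simp
    then show "y \<in> U" using N[OF x(1,3)] by blast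
  qed
  ultimately show "openin (markov_topology M) U"
    unfolding markov_topology_def openin_subtopology by blast
qed

lemma topspace_markov: "topspace (markov_topology M) = markov_shift M"
  by (auto simp: markov_topology_def markov_shift_def)

lemma openin_cylinder: "openin (markov_topology M) (cylinder M w)"
  unfolding openin_markov_iff cylinder_def by (auto intro!: exI[of _ "length w"])

lemma openin_coordinate: "openin (markov_topology M) {x \<in> markov_shift M. x i = a}"
  unfolding openin_markov_iff by (auto intro!: exI[of _ "Suc i"])

section \<open>The metric on extended sequences\<close>

lemma d_bar_coordinate: "(1 / 2) ^ Suc i * \<bar>recip (x i) - recip (y i)\<bar> \<le> d_bar x y"
proof -
  have "sum (\<lambda>i. (1 / 2) ^ Suc i * rho_bar (x i) (y i)) {i} \<le> d_bar x y"
    unfolding d_bar_def by (intro sum_le_suminf summable_d_bar) (auto simp: rho_bar_def)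
  then show ?thesis by (simp add: rho_bar_def)
qed

text \<open>
  The distance is controlled by finitely many coordinates: those from \<open>N\<close> on contribute at
  most \<open>2\<^sup>-\<^sup>N\<close>.
\<close>

lemma d_bar_le:
  assumes "\<And>i. i < N \<Longrightarrow> \<bar>recip (x i) - recip (y i)\<bar> \<le> e" and "0 \<le> e"
  shows "d_bar x y \<le> e + (1 / 2) ^ N"
proof -
  have g: "(\<lambda>i. (1 / 2 :: real) ^ Suc i) sums 1"
    using sums_mult[OF geometric_sums[of "1 / 2 :: real"], of "1 / 2"] by simp
  have t: "(\<lambda>i. (1 / 2 :: real) ^ N * (1 / 2) ^ Suc i) sums (1 / 2) ^ N"
    using sums_mult[OF g] by simp
  let ?h = "\<lambda>i. if i < N then 0 else (1 / 2 :: real) ^ Suc i"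
  have "(\<lambda>i. ?h (i + N)) sums (1 / 2) ^ N"
    using t by (simp add: power_add mult_ac)
  then have h: "?h sums (1 / 2) ^ N"
    using sums_iff_shift[of ?h N "(1 / 2) ^ N"] by simp
  have "(\<lambda>i. e * (1 / 2) ^ Suc i + ?h i) sums (e * 1 + (1 / 2) ^ N)"
    by (intro sums_add h sums_mult g)
  moreover have "(1 / 2) ^ Suc i * rho_bar (x i) (y i) \<le> e * (1 / 2) ^ Suc i + ?h i" for i
  proof (cases "i < N")
    case True
    then show ?thesis using assms(1)[of i] by (simp add: rho_bar_def)
  next
    case False
    have "rho_bar (x i) (y i) \<le> 1"
      using recip_bounds[of "x i"] recip_bounds[of "y i"] by (simp add: rho_bar_def)
    then have "(1 / 2) ^ Suc i * rho_bar (x i) (y i) \<le> (1 / 2) ^ Suc i"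
      by (intro mult_left_le) auto
    moreover have "0 \<le> e * (1 / 2) ^ Suc i" using \<open>0 \<le> e\<close> by simp
    ultimately show ?thesis using False by (simp only: if_False)
  qed
  ultimately have "d_bar x y \<le> e * 1 + (1 / 2) ^ N"
    unfolding d_bar_def by (intro sums_le[OF _ summable_sums[OF summable_d_bar]]) auto
  then show ?thesis by simp
qed

lemma d_bar_less:
  assumes "e > 0"
  shows "\<exists>N. \<exists>d>0. \<forall>x y. (\<forall>i<N. \<bar>recip (x i) - recip (y i)\<bar> \<le> d) \<longrightarrow> d_bar x y < e"
proof -
  obtain N where N: "(1 / 2 :: real) ^ N < e / 2"
    using real_arch_pow_inv[of "e / 2" "1 / 2"] assms by auto
  have "d_bar x y < e" if "\<forall>i<N. \<bar>recip (x i) - recip (y i)\<bar> \<le> e / 2" for x y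
    using d_bar_le[of N x y "e / 2"] that N assms by simp
  with assms show ?thesis by (intro exI[of _ N] exI[of _ "e / 2"]) simp
qed

lemma d_bar_shift_le: "d_bar (shift x) (shift y) \<le> 2 * d_bar x y"
proof -
  have "d_bar x y = (\<Sum>i. (1 / 2) ^ Suc (Suc i) * rho_bar (x (Suc i)) (y (Suc i)))
      + (1 / 2) * rho_bar (x 0) (y 0)"
    unfolding d_bar_def using suminf_split_head[OF summable_d_bar[of x y]] by simp
  also have "(\<Sum>i. (1 / 2) ^ Suc (Suc i) * rho_bar (x (Suc i)) (y (Suc i))) =
      (1 / 2) * d_bar (shift x) (shift y)"
    unfolding d_bar_def using suminf_mult[OF summable_d_bar[of "shift x" "shift y"], of "1 / 2"]
    by (simp add: shift_def mult.assoc)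
  finally show ?thesis by (simp add: rho_bar_def)
qed

lemma infinity_in_ext: "infinity_seq \<in> ext_sequences"
  by (simp add: infinity_seq_def ext_sequences_def)

lemma incl_in_ext: "x \<in> markov_shift M \<Longrightarrow> incl x \<in> ext_sequences"
  by (auto simp: incl_def ext_sequences_def markov_shift_def one_enat_def)

lemma compactification_subset: "compactification M \<subseteq> ext_sequences"
  unfolding compactification_def using closure_of_subset_topspace by fastforce

lemma topspace_compact: "topspace (compact_topology M) = compactification M"
  using compactification_subset by (auto simp: compact_topology_def)

lemma incl_in_compactification: "x \<in> markov_shift M \<Longrightarrow> incl x \<in> compactification M"
  unfolding compactification_def
  by (rule subsetD[OF closure_of_subset]) (auto intro: incl_in_ext)

lemma openin_compact_ball:
  assumes "openin (compact_topology M) V" "x \<in> V"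
  shows "\<exists>e>0. \<forall>y\<in>compactification M. d_bar x y < e \<longrightarrow> y \<in> V"
proof -
  obtain T where T: "openin ext.mtopology T" "V = T \<inter> compactification M"
    using assms(1) by (auto simp: compact_topology_def openin_subtopology)
  obtain r where "r > 0" "ext.mball x r \<subseteq> T"
    using T assms(2) ext.openin_mtopology by blast
  moreover have "x \<in> ext_sequences"
    using T(2) assms(2) compactification_subset by blast
  ultimately have "y \<in> V" if "y \<in> compactification M" "d_bar x y < r" for y
    using that T(2) compactification_subset[of M] by (auto simp: subset_iff)
  with \<open>r > 0\<close> show ?thesis by blast
qed

lemma openin_incl_vimage:
  assumes "openin (compact_topology M) V"
  shows "openin (markov_topology M) {x \<in> markov_shift M. incl x \<in> V}"
  unfolding openin_markov_iff
proof (intro conjI ballI)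
  fix x assume "x \<in> {x \<in> markov_shift M. incl x \<in> V}"
  then have "incl x \<in> V" by simp
  then obtain e where e: "e > 0" "\<forall>y\<in>compactification M. d_bar (incl x) y < e \<longrightarrow> y \<in> V"
    using openin_compact_ball[OF assms] by blast
  obtain N d where N: "d > 0"
    "\<forall>x y. (\<forall>i<N. \<bar>recip (x i) - recip (y i)\<bar> \<le> d) \<longrightarrow> d_bar x y < e"
    using d_bar_less[OF e(1)] by blast
  have "incl y \<in> V" if "y \<in> markov_shift M" "\<forall>i<N. y i = x i" for y
  proof -
    have "d_bar (incl x) (incl y) < e" using N that by (auto simp: incl_def)
    with e(2) incl_in_compactification[OF that(1)] show ?thesis by blast
  qed
  then show "\<exists>N. \<forall>y\<in>markov_shift M. (\<forall>i<N. y i = x i) \<longrightarrow>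
      y \<in> {x \<in> markov_shift M. incl x \<in> V}"
    by blast
qed auto

lemma continuous_map_incl: "continuous_map (markov_topology M) (compact_topology M) incl"
  unfolding continuous_map_def topspace_markov topspace_compact
  using incl_in_compactification openin_incl_vimage by auto

lemma recip_le:
  assumes "k < a"
  shows "recip (enat a) \<le> 1 / real (Suc k)"
  using assms by (simp add: recip_def frac_le)

lemma d_bar_infinity_less:
  assumes "e > 0"
  shows "\<exists>N k. \<forall>y. (\<forall>i<N. k < y i) \<longrightarrow> d_bar infinity_seq (incl y) < e"
proof -
  obtain N d where N: "d > 0"
    "\<forall>x y. (\<forall>i<N. \<bar>recip (x i) - recip (y i)\<bar> \<le> d) \<longrightarrow> d_bar x y < e"
    using d_bar_less[OF assms] by blast
  obtain k where k: "1 / real (Suc k) < d" using nat_approx_posE[OF N(1)] by blast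
  have "\<bar>recip (infinity_seq i) - recip (incl y i)\<bar> \<le> d" if "k < y i" for y i
  proof -
    have "\<bar>recip (infinity_seq i) - recip (incl y i)\<bar> = recip (enat (y i))"
      by (simp add: infinity_seq_def incl_def recip_def)
    then show ?thesis using recip_le[OF that] k by linarith
  qed
  then have "d_bar infinity_seq (incl y) < e" if "\<forall>i<N. k < y i" for y
    using that by (intro N(2)[rule_format]) auto
  then show ?thesis by (intro exI allI impI)
qed

text \<open>
  A neighbourhood of \<open>infinity_seq\<close> contains every point of the Markov shift whose first
  coordinates are all large.
\<close>

lemma openin_infinity_tail:
  assumes "openin (compact_topology M) V" "infinity_seq \<in> V"
  shows "\<exists>N k. \<forall>y\<in>markov_shift M. (\<forall>i<N. k < y i) \<longrightarrow> incl y \<in> V"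
proof -
  obtain e where e: "e > 0" "\<forall>y\<in>compactification M. d_bar infinity_seq y < e \<longrightarrow> y \<in> V"
    using openin_compact_ball[OF assms] by blast
  obtain N k where "\<forall>y. (\<forall>i<N. k < y i) \<longrightarrow> d_bar infinity_seq (incl y) < e"
    using d_bar_infinity_less[OF e(1)] by blast
  then have "incl y \<in> V" if "y \<in> markov_shift M" "\<forall>i<N. k < y i" for y
    using e(2) incl_in_compactification[OF that(1)] that(2) by auto
  then show ?thesis by (intro exI ballI impI)
qed

lemma infinity_in_compactification:
  assumes "\<And>N k. \<exists>y\<in>markov_shift M. \<forall>i<N. k < y i"
  shows "infinity_seq \<in> compactification M"
  unfolding compactification_def ext.metric_closure_of
proof (intro CollectI conjI allI impI infinity_in_ext)
  fix e :: real assume "e > 0"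
  then obtain N k where N: "\<forall>y. (\<forall>i<N. k < y i) \<longrightarrow> d_bar infinity_seq (incl y) < e"
    using d_bar_infinity_less by blast
  obtain y where y: "y \<in> markov_shift M" "\<forall>i<N. k < y i" using assms by blast
  then have "incl y \<in> ext.mball infinity_seq e"
    using N infinity_in_ext incl_in_ext by simp
  then show "\<exists>z\<in>incl ` markov_shift M. z \<in> ext.mball infinity_seq e"
    using y(1) by blast
qed

lemma shift_markov: "x \<in> markov_shift M \<Longrightarrow> shift x \<in> markov_shift M"
  by (simp add: markov_shift_def shift_def)

lemma shift_incl: "shift (incl x) = incl (shift x)"
  by (simp add: shift_def incl_def)

lemma continuous_map_shift_ext: "continuous_map ext.mtopology ext.mtopology shift"
  unfolding ext.continuous_map_to_metric
proof (intro ballI allI impI)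
  fix x and e :: real assume x: "x \<in> topspace ext.mtopology" and e: "e > 0"
  have s: "shift y \<in> ext_sequences" if "y \<in> ext_sequences" for y
    using that by (auto simp: ext_sequences_def shift_def)
  show "\<exists>U. openin ext.mtopology U \<and> x \<in> U \<and> (\<forall>y\<in>U. shift y \<in> ext.mball (shift x) e)"
  proof (intro exI[of _ "ext.mball x (e / 2)"] conjI ballI)
    fix y assume "y \<in> ext.mball x (e / 2)"
    then show "shift y \<in> ext.mball (shift x) e"
      using d_bar_shift_le[of x y] s by simp
  qed (use x e in auto)
qed

lemma shift_compactification: "shift ` compactification M \<subseteq> compactification M"
proof -
  have "shift ` compactification M \<subseteq> ext.mtopology closure_of (shift ` incl ` markov_shift M)"
    unfolding compactification_def
    by (rule continuous_map_image_closure_subset[OF continuous_map_shift_ext])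
  also have "\<dots> \<subseteq> compactification M"
    unfolding compactification_def
    by (rule closure_of_mono) (auto simp: shift_incl intro: shift_markov)
  finally show ?thesis .
qed

lemma continuous_map_shift_compact: "continuous_map (compact_topology M) (compact_topology M) shift"
  unfolding compact_topology_def continuous_map_in_subtopology
  using continuous_map_shift_ext shift_compactification topspace_compact[of M]
  by (auto intro: continuous_map_from_subtopology simp: compact_topology_def image_subset_iff)

lemma continuous_map_recip: "continuous_map (compact_topology M) euclideanreal (\<lambda>x. recip (x i))"
  unfolding continuous_map_def
proof (intro conjI allI impI)
  fix U :: "real set" assume "openin euclideanreal U"
  have "openin ext.mtopology {x \<in> ext_sequences. recip (x i) \<in> U}"
    unfolding ext.openin_mtopology
  proof (intro conjI allI impI)
    show "{x \<in> ext_sequences. recip (x i) \<in> U} \<subseteq> ext_sequences" by blast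
    fix x assume x: "x \<in> {x \<in> ext_sequences. recip (x i) \<in> U}"
    then obtain e where e: "e > 0" "ball (recip (x i)) e \<subseteq> U"
      using \<open>openin euclideanreal U\<close> open_contains_ball[of U] by auto
    have "recip (y i) \<in> U" if "d_bar x y < (1 / 2) ^ Suc i * e" for y
    proof -
      have "(1 / 2) ^ Suc i * \<bar>recip (x i) - recip (y i)\<bar> < (1 / 2) ^ Suc i * e"
        using d_bar_coordinate[where x = x and y = y and i = i] that by linarith
      then have "\<bar>recip (x i) - recip (y i)\<bar> < e" by (rule mult_left_less_imp_less) simp
      then show ?thesis using e(2) by (auto simp: subset_iff dist_real_def)
    qed
    then show "\<exists>r>0. ext.mball x r \<subseteq> {x \<in> ext_sequences. recip (x i) \<in> U}"
      using e(1) by (intro exI[of _ "(1 / 2) ^ Suc i * e"]) auto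
  qed
  then have "openin (compact_topology M)
      ({x \<in> ext_sequences. recip (x i) \<in> U} \<inter> compactification M)"
    unfolding compact_topology_def openin_subtopology by blast
  also have "{x \<in> ext_sequences. recip (x i) \<in> U} \<inter> compactification M =
      {x \<in> topspace (compact_topology M). recip (x i) \<in> U}"
    by (auto simp: topspace_compact dest: subsetD[OF compactification_subset])
  finally show "openin (compact_topology M) {x \<in> topspace (compact_topology M). recip (x i) \<in> U}" .
qed auto

text \<open>
  The extended sequences are the continuous image, under the coordinatewise inverse of
  \<open>recip\<close>, of a countable power of the compact set \<open>{0} \<union> {1, 1/2, 1/3, \<dots>}\<close>; that power is
  compact by Tychonoff's theorem, and the compactification is closed in the image.
\<close>

lemma compact_space_compact_topology: "compact_space (compact_topology M)"
proof -
  define S where "S = insert 0 (range (\<lambda>n. inverse (real (Suc n))))"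
  have "compact S"
    unfolding S_def by (rule compact_sequence_with_limit[OF LIMSEQ_inverse_real_of_nat])
  let ?P = "product_topology (\<lambda>_::nat. top_of_set S) UNIV"
  \<comment> \<open>\<open>THE\<close> is well defined for values in \<open>S\<close> because \<open>recip\<close> is injective on positive arguments.\<close>
  define g where "g r = (\<lambda>i::nat. THE a. 1 \<le> a \<and> recip a = r i)" for r
  have g: "1 \<le> g r i" "recip (g r i) = r i" if "r \<in> topspace ?P" for r i
  proof -
    have "r i \<in> S" using that by auto
    then consider "r i = recip \<infinity>" | n where "r i = recip (enat (Suc n))"
      by (auto simp: S_def recip_def inverse_eq_divide)
    then obtain a where a: "1 \<le> a \<and> recip a = r i"
      using that[of \<infinity>] that[of "enat (Suc n)" for n] by cases (auto simp: one_enat_def)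
    then have "1 \<le> g r i \<and> recip (g r i) = r i"
      unfolding g_def
    proof (rule theI)
      fix b assume "1 \<le> b \<and> recip b = r i"
      then show "b = a" using a recip_inj[of b a] by simp
    qed
    then show "1 \<le> g r i" "recip (g r i) = r i" by auto
  qed
  have g_ext: "g r \<in> ext_sequences" if "r \<in> topspace ?P" for r
    unfolding ext_sequences_def using g(1)[OF that] by blast
  have "continuous_map ?P ext.mtopology g"
    unfolding ext.continuous_map_to_metric
  proof (intro ballI allI impI)
    fix r and e :: real assume r: "r \<in> topspace ?P" and e: "e > 0"
    obtain N d where N: "d > 0"
      "\<forall>x y. (\<forall>i<N. \<bar>recip (x i) - recip (y i)\<bar> \<le> d) \<longrightarrow> d_bar x y < e"
      using d_bar_less[OF e(1)] by blast
    define U where "U = PiE UNIV (\<lambda>i. if i < N then S \<inter> ball (r i) d else S)"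
    have "finite {i. (if i < N then S \<inter> ball (r i) d else S) \<noteq> S}"
      by (rule finite_subset[of _ "{..<N}"]) auto
    then have "openin ?P U"
      unfolding U_def by (subst openin_PiE_gen) (auto simp: openin_open_Int)
    moreover have "r \<in> U" using r N(1) by (auto simp: U_def PiE_iff)
    moreover have "g s \<in> ext.mball (g r) e" if "s \<in> U" for s
    proof -
      have s: "s \<in> topspace ?P" using that \<open>openin ?P U\<close> openin_subset by blast
      have "\<bar>recip (g r i) - recip (g s i)\<bar> \<le> d" if "i < N" for i
        using PiE_mem[OF \<open>s \<in> U\<close>[unfolded U_def], of i] that
        unfolding g[OF r] g[OF s] by (simp add: dist_real_def)
      then have "d_bar (g r) (g s) < e" by (intro N(2)[rule_format])
      then show ?thesis using g_ext r s by simp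
    qed
    ultimately show "\<exists>U. openin ?P U \<and> r \<in> U \<and> (\<forall>y\<in>U. g y \<in> ext.mball (g r) e)" by blast
  qed
  moreover have "compact_space ?P"
    using \<open>compact S\<close> by (simp add: compact_space_product_topology compact_space_subtopology)
  ultimately have "compactin ext.mtopology (g ` topspace ?P)"
    using image_compactin compact_space_def by blast
  moreover have "g ` topspace ?P = ext_sequences"
  proof (intro equalityI subsetI)
    fix x assume x: "x \<in> ext_sequences"
    have "recip (x i) \<in> S" for i
      using x unfolding S_def ext_sequences_def
      by (cases "x i") (auto simp: recip_def inverse_eq_divide one_enat_def
          intro!: image_eqI[of _ _ "the_enat (x i) - 1"])
    then have r: "(\<lambda>i. recip (x i)) \<in> topspace ?P" by auto
    have "g (\<lambda>i. recip (x i)) = x"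
      using g[OF r] x recip_inj by (auto simp: ext_sequences_def fun_eq_iff)
    with r show "x \<in> g ` topspace ?P" by (metis image_eqI)
  qed (use g_ext in blast)
  ultimately show ?thesis
    unfolding compact_topology_def compactification_def
    by (intro compact_space_subtopology closed_compactin[OF _ closure_of_subset_topspace])
      (simp_all)
qed

section \<open>Borel measures and invariance\<close>

lemma space_borel_of [simp]: "space (borel_of X) = topspace X"
  using openin_subset unfolding borel_of_def by (subst space_measure_of) auto

lemma sets_borel_of: "sets (borel_of X) = sigma_sets (topspace X) {U. openin X U}"
  using openin_subset unfolding borel_of_def by (subst sets_measure_of) auto

lemma openin_borel_of: "openin X U \<Longrightarrow> U \<in> sets (borel_of X)"
  unfolding sets_borel_of by (rule sigma_sets.Basic) simp

lemma measurable_borel_of: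
  assumes "continuous_map X Y f"
  shows "f \<in> borel_of X \<rightarrow>\<^sub>M borel_of Y"
  unfolding borel_of_def[of Y]
proof (rule measurable_measure_of)
  show "f \<in> space (borel_of X) \<rightarrow> topspace Y"
    using assms by (auto simp: continuous_map_def)
  fix U assume "U \<in> {U. openin Y U}"
  then have "openin X {x \<in> topspace X. f x \<in> U}"
    using assms by (simp add: continuous_map_def)
  then show "f -` U \<inter> space (borel_of X) \<in> sets (borel_of X)"
    using openin_borel_of by (simp add: vimage_def Int_def conj_commute)
qed (use openin_subset in auto)

lemma borel_measurable_borel_of:
  fixes f :: "'a \<Rightarrow> 'b :: topological_space"
  assumes "continuous_map X euclidean f"
  shows "f \<in> borel_measurable (borel_of X)"
proof (rule borel_measurableI)
  fix S :: "'b set" assume "open S"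
  then have "openin X {x \<in> topspace X. f x \<in> S}"
    using assms by (simp add: continuous_map_def)
  then show "f -` S \<inter> space (borel_of X) \<in> sets (borel_of X)"
    using openin_borel_of by (simp add: vimage_def Int_def conj_commute)
qed

lemma
  assumes "\<mu> \<in> invariant_prob M"
  shows invariant_prob_sets: "sets \<mu> = sets (borel_of (markov_topology M))"
    and invariant_prob_space: "space \<mu> = markov_shift M"
    and invariant_prob_prob: "prob_space \<mu>"
    and invariant_prob_inv: "shift_invariant \<mu>"
  using assms sets_eq_imp_space_eq[of \<mu>] by (auto simp: invariant_prob_def topspace_markov)

lemma invariant_prob_openin:
  "\<mu> \<in> invariant_prob M \<Longrightarrow> openin (markov_topology M) U \<Longrightarrow> U \<in> sets \<mu>"
  by (simp add: invariant_prob_sets openin_borel_of)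

lemma scale_in_invariant_subprob:
  assumes "\<mu> \<in> invariant_prob M" "0 \<le> c" "c \<le> 1"
  shows "scale_measure (ennreal c) \<mu> \<in> invariant_subprob M"
proof -
  interpret prob_space \<mu> by (rule invariant_prob_prob[OF assms(1)])
  have "subprob_space (scale_measure (ennreal c) \<mu>)"
    using assms(3) not_empty by (intro subprob_spaceI) (simp_all add: space_scale_measure emeasure_space_1)
  then show ?thesis
    using assms(1) by (simp add: invariant_subprob_def invariant_prob_def shift_invariant_def space_scale_measure)
qed

lemma invariant_prob_subprob: "\<mu> \<in> invariant_prob M \<Longrightarrow> \<mu> \<in> invariant_subprob M"
  by (auto simp: invariant_prob_def invariant_subprob_def intro: prob_space_imp_subprob_space)

lemma measure_scale: "0 \<le> c \<Longrightarrow> measure (scale_measure (ennreal c) \<mu>) A = c * measure \<mu> A"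
  by (simp add: measure_def enn2real_mult)

text \<open>By invariance, one-letter cylinders have the same mass at every coordinate.\<close>

lemma measure_coordinate:
  assumes "\<mu> \<in> invariant_prob M"
  shows "measure \<mu> {x \<in> markov_shift M. x i = a} = measure \<mu> (cylinder M [a])"
proof (induction i)
  case 0
  then show ?case by (simp add: cylinder_def)
next
  case (Suc i)
  have "emeasure \<mu> (shift -` {x \<in> markov_shift M. x i = a} \<inter> space \<mu>) =
      emeasure \<mu> {x \<in> markov_shift M. x i = a}"
    using bspec[OF invariant_prob_inv[OF assms, unfolded shift_invariant_def]
      invariant_prob_openin[OF assms openin_coordinate]] .
  moreover have "shift -` {x \<in> markov_shift M. x i = a} \<inter> space \<mu> =
      {x \<in> markov_shift M. x (Suc i) = a}"
    using shift_markov by (auto simp: invariant_prob_space[OF assms] shift_def)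
  ultimately show ?case using Suc by (simp add: measure_def)
qed

section \<open>Measures on the compactification\<close>

lemma measurable_incl:
  "\<mu> \<in> invariant_prob M \<Longrightarrow> incl \<in> \<mu> \<rightarrow>\<^sub>M borel_of (compact_topology M)"
  using measurable_borel_of[OF continuous_map_incl]
  by (simp add: invariant_prob_sets cong: measurable_cong_sets)

lemma emeasure_extend:
  assumes "\<mu> \<in> invariant_prob M" "A \<in> sets (borel_of (compact_topology M))"
  shows "emeasure (extend_measure_to M \<mu>) A = emeasure \<mu> {x \<in> markov_shift M. incl x \<in> A}"
  unfolding extend_measure_to_def
  using assms by (simp add: emeasure_distr measurable_incl invariant_prob_space vimage_def Int_def conj_commute)

lemma sets_extend [simp]: "sets (extend_measure_to M \<mu>) = sets (borel_of (compact_topology M))"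
  and space_extend [simp]: "space (extend_measure_to M \<mu>) = compactification M"
  by (simp_all add: extend_measure_to_def topspace_compact)

lemma prob_space_extend: "\<mu> \<in> invariant_prob M \<Longrightarrow> prob_space (extend_measure_to M \<mu>)"
  unfolding extend_measure_to_def
  using prob_space.prob_space_distr[OF invariant_prob_prob measurable_incl] .

lemma shift_vimage_borel:
  assumes "A \<in> sets (borel_of (compact_topology M))"
  shows "shift -` A \<inter> compactification M \<in> sets (borel_of (compact_topology M))"
  using measurable_sets[OF measurable_borel_of[OF continuous_map_shift_compact] assms]
  by (simp add: topspace_compact)

lemma emeasure_extend_shift:
  assumes "\<mu> \<in> invariant_prob M" "A \<in> sets (borel_of (compact_topology M))"
  shows "emeasure (extend_measure_to M \<mu>) (shift -` A \<inter> compactification M) =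
    emeasure (extend_measure_to M \<mu>) A"
proof -
  have "{x \<in> markov_shift M. incl x \<in> A} \<in> sets \<mu>"
    using measurable_sets[OF measurable_incl[OF assms(1)] assms(2)]
    by (simp add: invariant_prob_space[OF assms(1)] vimage_def Int_def conj_commute)
  from bspec[OF invariant_prob_inv[OF assms(1), unfolded shift_invariant_def] this] have
    "emeasure \<mu> (shift -` {x \<in> markov_shift M. incl x \<in> A} \<inter> markov_shift M) =
      emeasure \<mu> {x \<in> markov_shift M. incl x \<in> A}"
    unfolding invariant_prob_space[OF assms(1)] .
  moreover have "shift -` {x \<in> markov_shift M. incl x \<in> A} \<inter> markov_shift M =
      {x \<in> markov_shift M. incl x \<in> shift -` A \<inter> compactification M}"
    using shift_markov incl_in_compactification by (auto simp: shift_incl)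
  ultimately show ?thesis
    using assms shift_vimage_borel by (simp add: emeasure_extend)
qed

lemma extend_in_compact_invariant_prob:
  "\<mu> \<in> invariant_prob M \<Longrightarrow> extend_measure_to M \<mu> \<in> compact_invariant_prob M"
  by (simp add: compact_invariant_prob_def prob_space_extend shift_invariant_def emeasure_extend_shift)

lemma sets_add_measure [simp]: "sets (add_measure \<mu> \<nu>) = sets \<mu>"
  and space_add_measure [simp]: "space (add_measure \<mu> \<nu>) = space \<mu>"
  by (simp_all add: add_measure_def)

lemma emeasure_add_measure:
  assumes "sets \<nu> = sets \<mu>" "A \<in> sets \<mu>"
  shows "emeasure (add_measure \<mu> \<nu>) A = emeasure \<mu> A + emeasure \<nu> A"
  unfolding add_measure_def
proof (rule emeasure_measure_of_sigma)
  show "sigma_algebra (space \<mu>) (sets \<mu>)" ..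
  show "positive (sets \<mu>) (\<lambda>A. emeasure \<mu> A + emeasure \<nu> A)" by (simp add: positive_def)
  show "countably_additive (sets \<mu>) (\<lambda>A. emeasure \<mu> A + emeasure \<nu> A)"
  proof (rule countably_additiveI)
    fix A :: "nat \<Rightarrow> 'a set" assume A: "range A \<subseteq> sets \<mu>" "disjoint_family A"
    then show "(\<Sum>i. emeasure \<mu> (A i) + emeasure \<nu> (A i)) =
        emeasure \<mu> (\<Union>(range A)) + emeasure \<nu> (\<Union>(range A))"
      using assms(1) by (subst suminf_add[symmetric]) (auto simp: suminf_emeasure)
  qed
qed (rule assms)

lemma sets_mix [simp]: "sets (mix_with_infinity M c \<mu>) = sets (borel_of (compact_topology M))"
  and space_mix [simp]: "space (mix_with_infinity M c \<mu>) = compactification M"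
  by (simp_all add: mix_with_infinity_def space_scale_measure)

lemma emeasure_mix:
  assumes "\<mu> \<in> invariant_prob M" "A \<in> sets (borel_of (compact_topology M))"
  shows "emeasure (mix_with_infinity M c \<mu>) A =
    ennreal c * emeasure \<mu> {x \<in> markov_shift M. incl x \<in> A} +
    ennreal (1 - c) * indicator A infinity_seq"
  using assms by (simp add: mix_with_infinity_def emeasure_add_measure emeasure_extend)

lemma measure_mix:
  assumes "\<mu> \<in> invariant_prob M" "A \<in> sets (borel_of (compact_topology M))" "0 \<le> c" "c \<le> 1"
  shows "measure (mix_with_infinity M c \<mu>) A =
    c * measure \<mu> {x \<in> markov_shift M. incl x \<in> A} + (1 - c) * indicator A infinity_seq"
proof -
  interpret prob_space \<mu> by (rule invariant_prob_prob[OF assms(1)])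
  let ?r = "c * measure \<mu> {x \<in> markov_shift M. incl x \<in> A} + (1 - c) * indicator A infinity_seq"
  have "emeasure (mix_with_infinity M c \<mu>) A = ennreal ?r"
    using assms by (auto simp: emeasure_mix emeasure_eq_measure ennreal_plus ennreal_mult indicator_def)
  moreover have "0 \<le> ?r" using assms(3,4) by simp
  ultimately show ?thesis
    by (simp only: measure_def[of "mix_with_infinity M c \<mu>"] enn2real_ennreal)
qed

lemma mix_in_compact_invariant_prob:
  assumes "\<mu> \<in> invariant_prob M" "0 \<le> c" "c \<le> 1" "infinity_seq \<in> compactification M"
  shows "mix_with_infinity M c \<mu> \<in> compact_invariant_prob M"
proof -
  have "compactification M \<in> sets (borel_of (compact_topology M))"
    using sets.top[of "borel_of (compact_topology M)"] by (simp add: topspace_compact)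
  moreover have "{x \<in> markov_shift M. incl x \<in> compactification M} = space \<mu>"
    using incl_in_compactification invariant_prob_space[OF assms(1)] by auto
  ultimately have "emeasure (mix_with_infinity M c \<mu>) (compactification M) = 1"
    using assms prob_space.emeasure_space_1[OF invariant_prob_prob[OF assms(1)]]
    by (simp add: emeasure_mix flip: ennreal_plus)
  then have "prob_space (mix_with_infinity M c \<mu>)"
    by (intro prob_spaceI) simp
  moreover have "shift_invariant (mix_with_infinity M c \<mu>)"
    unfolding shift_invariant_def
  proof
    fix A assume "A \<in> sets (mix_with_infinity M c \<mu>)"
    then have A: "A \<in> sets (borel_of (compact_topology M))" by simp
    have "shift infinity_seq = infinity_seq" by (simp add: shift_def infinity_seq_def)
    then show "emeasure (mix_with_infinity M c \<mu>)
        (shift -` A \<inter> space (mix_with_infinity M c \<mu>)) = emeasure (mix_with_infinity M c \<mu>) A"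
      using emeasure_extend_shift[OF assms(1) A] A shift_vimage_borel[OF A] assms(1,4)
      by (simp add: emeasure_mix emeasure_extend indicator_def)
  qed
  ultimately show ?thesis by (simp add: compact_invariant_prob_def)
qed

section \<open>Lower semicontinuity on open sets\<close>

text \<open>
  The nonempty words whose cylinder is contained in \<open>U\<close> and which have no shorter nonempty
  prefix with this property.  They decompose an open
  set into countably many disjoint cylinders.  The empty word is not used, since convergence
  on cylinders says nothing about the whole space.  Words that contain the letter \<open>0\<close> may
  occur; their cylinders are empty.
\<close>

definition minimal_words :: "(nat \<Rightarrow> nat \<Rightarrow> nat) \<Rightarrow> (nat \<Rightarrow> nat) set \<Rightarrow> nat list set" where
  "minimal_words M U = {w. w \<noteq> [] \<and> cylinder M w \<subseteq> U \<and>
     (\<forall>k. 0 < k \<longrightarrow> k < length w \<longrightarrow> \<not> cylinder M (take k w) \<subseteq> U)}"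

lemma cylinder_nth: "x \<in> cylinder M w \<Longrightarrow> i < length w \<Longrightarrow> w ! i = x i"
  by (simp add: cylinder_def)

lemma disjoint_minimal_words: "disjoint_family_on (cylinder M) (minimal_words M U)"
proof -
  have *: False
    if wv: "w \<in> minimal_words M U" "v \<in> minimal_words M U" and
      x: "x \<in> cylinder M w" "x \<in> cylinder M v" and len: "length w < length v" for w v x
  proof -
    have "take (length w) v = w"
      using len by (intro nth_equalityI) (simp_all add: cylinder_nth[OF x(1)] cylinder_nth[OF x(2)])
    moreover have "0 < length w" "cylinder M w \<subseteq> U"
      and "\<And>k. 0 < k \<Longrightarrow> k < length v \<Longrightarrow> \<not> cylinder M (take k v) \<subseteq> U"
      using wv by (auto simp: minimal_words_def)
    ultimately show False using len by metis
  qed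
  show ?thesis
    unfolding disjoint_family_on_def
  proof (intro ballI impI equals0I)
    fix w v x assume wv: "w \<in> minimal_words M U" "v \<in> minimal_words M U" "w \<noteq> v"
      and "x \<in> cylinder M w \<inter> cylinder M v"
    then have x: "x \<in> cylinder M w" "x \<in> cylinder M v" by auto
    have "length w = length v"
      using *[OF wv(1,2) x] *[OF wv(2,1) x(2,1)] by (metis linorder_neqE_nat)
    then have "w = v"
      by (intro nth_equalityI) (simp_all add: cylinder_nth[OF x(1)] cylinder_nth[OF x(2)])
    with wv(3) show False ..
  qed
qed

lemma Union_minimal_words:
  assumes "openin (markov_topology M) U"
  shows "(\<Union>w\<in>minimal_words M U. cylinder M w) = U"
proof (intro equalityI subsetI)
  fix x assume x: "x \<in> U"
  let ?P = "\<lambda>k. 0 < k \<and> cylinder M (map x [0..<k]) \<subseteq> U"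
  obtain N where N: "\<forall>y\<in>markov_shift M. (\<forall>i<N. y i = x i) \<longrightarrow> y \<in> U"
    using assms x unfolding openin_markov_iff by blast
  then have "?P (Suc N)" by (auto simp: cylinder_def simp del: upt_Suc)
  define L where "L = (LEAST k. ?P k)"
  have L: "?P L" unfolding L_def by (rule LeastI) fact
  have "\<not> ?P k" if "k < L" for k
    using that unfolding L_def by (rule not_less_Least)
  then have "map x [0..<L] \<in> minimal_words M U"
    using L by (auto simp: minimal_words_def take_map)
  moreover have "x \<in> cylinder M (map x [0..<L])"
    using assms x by (auto simp: cylinder_def openin_markov_iff)
  ultimately show "x \<in> (\<Union>w\<in>minimal_words M U. cylinder M w)" by blast
qed (auto simp: minimal_words_def)

text \<open>
  The total mass of a disjoint union is a sum over the pieces, so Fatou's lemma for counting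
  measure turns convergence on cylinders into a lower bound on open sets.  Strict lower bounds
  \<open>y\<close> express the inequality for the limit inferior.
\<close>

lemma liminf_openin:
  fixes \<mu>s :: "nat \<Rightarrow> (nat \<Rightarrow> nat) measure"
  assumes \<mu>s: "\<And>n. finite_measure (\<mu>s n)" "\<And>n. sets (\<mu>s n) = sets (borel_of (markov_topology M))"
    and \<nu>: "finite_measure \<nu>" "sets \<nu> = sets (borel_of (markov_topology M))"
    and conv: "\<And>w. w \<noteq> [] \<Longrightarrow> (\<lambda>n. measure (\<mu>s n) (cylinder M w)) \<longlonglongrightarrow> measure \<nu> (cylinder M w)"
    and U: "openin (markov_topology M) U"
    and y: "y < measure \<nu> U"
  shows "\<forall>\<^sub>F n in sequentially. y < measure (\<mu>s n) U"
proof (cases "y < 0")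
  case True
  then show ?thesis
    by (intro always_eventually allI order.strict_trans2[OF True measure_nonneg])
next
  case False
  let ?W = "minimal_words M U"
  have sum: "emeasure m U = (\<integral>\<^sup>+w. emeasure m (cylinder M w) \<partial>count_space ?W)"
    if "sets m = sets (borel_of (markov_topology M))" for m
    using emeasure_UN_countable[of ?W "cylinder M" m] disjoint_minimal_words
    by (simp add: that openin_borel_of openin_cylinder Union_minimal_words[OF U])
  have "emeasure \<nu> U = (\<integral>\<^sup>+w. liminf (\<lambda>n. emeasure (\<mu>s n) (cylinder M w)) \<partial>count_space ?W)"
    unfolding sum[OF \<nu>(2)]
  proof (rule nn_integral_cong)
    fix w assume "w \<in> space (count_space ?W)"
    then have "w \<noteq> []" by (simp add: minimal_words_def)
    then have "(\<lambda>n. emeasure (\<mu>s n) (cylinder M w)) \<longlonglongrightarrow> emeasure \<nu> (cylinder M w)"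
      using conv \<mu>s(1) \<nu>(1) by (simp add: finite_measure.emeasure_eq_measure)
    then show "emeasure \<nu> (cylinder M w) = liminf (\<lambda>n. emeasure (\<mu>s n) (cylinder M w))"
      by (simp add: lim_imp_Liminf)
  qed
  also have "\<dots> \<le> liminf (\<lambda>n. emeasure (\<mu>s n) U)"
    unfolding sum[OF \<mu>s(2)] by (rule nn_integral_liminf) simp
  finally have "ennreal (measure \<nu> U) \<le> liminf (\<lambda>n. ennreal (measure (\<mu>s n) U))"
    using \<mu>s(1) \<nu>(1) by (simp add: finite_measure.emeasure_eq_measure)
  moreover have "ennreal y < ennreal (measure \<nu> U)"
    using y False by (simp add: ennreal_less_iff)
  ultimately have "\<forall>\<^sub>F n in sequentially. ennreal y < ennreal (measure (\<mu>s n) U)"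
    unfolding le_Liminf_iff by blast
  then show ?thesis
    using False by (simp add: ennreal_less_iff)
qed

lemma measure_modular:
  assumes "finite_measure m" "A \<in> sets m" "B \<in> sets m"
  shows "measure m (A \<union> B) = measure m A + measure m B - measure m (A \<inter> B)"
  using finite_measure.finite_measure_Union'[OF assms]
    finite_measure.finite_measure_Diff'[OF assms(1,3,2)]
  by (simp add: Int_commute)

text \<open>
  If the masses of two open sets converge, then so does the mass of their union:
  \<open>m (A \<union> B) = m A + m B - m (A \<inter> B)\<close>, where lower semicontinuity on the open set
  \<open>A \<inter> B\<close> bounds the limit superior from above.
\<close>

lemma tendsto_measure_finite_Union:
  fixes \<mu>s :: "nat \<Rightarrow> (nat \<Rightarrow> nat) measure"
  assumes \<mu>s: "\<And>n. finite_measure (\<mu>s n)" "\<And>n. sets (\<mu>s n) = sets (borel_of (markov_topology M))"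
    and \<nu>: "finite_measure \<nu>" "sets \<nu> = sets (borel_of (markov_topology M))"
    and conv: "\<And>w. w \<noteq> [] \<Longrightarrow> (\<lambda>n. measure (\<mu>s n) (cylinder M w)) \<longlonglongrightarrow> measure \<nu> (cylinder M w)"
    and "finite \<A>" "\<And>A. A \<in> \<A> \<Longrightarrow> openin (markov_topology M) A"
      "\<And>A. A \<in> \<A> \<Longrightarrow> (\<lambda>n. measure (\<mu>s n) A) \<longlonglongrightarrow> measure \<nu> A"
  shows "(\<lambda>n. measure (\<mu>s n) (\<Union>\<A>)) \<longlonglongrightarrow> measure \<nu> (\<Union>\<A>)"
  using assms(6-)
proof (induction \<A> rule: finite_induct)
  case empty
  then show ?case by simp
next
  case (insert A \<A>)
  let ?B = "\<Union>\<A>"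
  have op: "openin (markov_topology M) A" "openin (markov_topology M) ?B"
    using insert.prems(1) by auto
  then have op': "openin (markov_topology M) (A \<inter> ?B)" "openin (markov_topology M) (A \<union> ?B)"
    by (auto intro: openin_Int openin_Un)
  have modular: "measure m (A \<union> ?B) = measure m A + measure m ?B - measure m (A \<inter> ?B)"
    if "finite_measure m" "sets m = sets (borel_of (markov_topology M))" for m
    using op that(2) openin_borel_of by (intro measure_modular that) auto
  have sum: "(\<lambda>n. measure (\<mu>s n) A + measure (\<mu>s n) ?B) \<longlonglongrightarrow> measure \<nu> A + measure \<nu> ?B"
    using insert by (intro tendsto_add) auto
  have "(\<lambda>n. measure (\<mu>s n) (A \<union> ?B)) \<longlonglongrightarrow> measure \<nu> (A \<union> ?B)"
  proof (rule order_tendstoI)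
    fix y assume "y < measure \<nu> (A \<union> ?B)"
    then show "\<forall>\<^sub>F n in sequentially. y < measure (\<mu>s n) (A \<union> ?B)"
      by (intro liminf_openin[OF \<mu>s \<nu> conv op'(2)])
  next
    fix y assume y: "measure \<nu> (A \<union> ?B) < y"
    define d where "d = (y - measure \<nu> (A \<union> ?B)) / 2"
    have d: "d > 0" using y by (simp add: d_def)
    have "\<forall>\<^sub>F n in sequentially. measure \<nu> (A \<inter> ?B) - d < measure (\<mu>s n) (A \<inter> ?B)"
      using d by (intro liminf_openin[OF \<mu>s \<nu> conv op'(1)]) auto
    moreover have "\<forall>\<^sub>F n in sequentially.
        measure (\<mu>s n) A + measure (\<mu>s n) ?B < measure \<nu> A + measure \<nu> ?B + d"
      using d by (intro order_tendstoD(2)[OF sum]) auto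
    ultimately show "\<forall>\<^sub>F n in sequentially. measure (\<mu>s n) (A \<union> ?B) < y"
    proof eventually_elim
      case (elim n)
      have "y = measure \<nu> (A \<union> ?B) + 2 * d" by (simp add: d_def field_simps)
      then show ?case
        using elim modular[OF \<mu>s, of n] modular[OF \<nu>] by linarith
    qed
  qed
  then show ?case by simp
qed

section \<open>Weak convergence from open sets\<close>

lemma weak_conv_m_openI:
  assumes Q: "\<And>n. real_distribution (Qs n)" "real_distribution Q"
    and lim: "\<And>S y. open S \<Longrightarrow> y < measure Q S \<Longrightarrow> \<forall>\<^sub>F n in sequentially. y < measure (Qs n) S"
  shows "weak_conv_m Qs Q"
  unfolding weak_conv_m_def weak_conv_def
proof (intro allI impI)
  fix x :: real assume x: "isCont (cdf Q) x"
  interpret Q: real_distribution Q by fact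
  interpret Qs: real_distribution "Qs n" for n by fact
  have "measure Q {x} = 0" using x by (simp add: Q.isCont_cdf)
  moreover have "{..x} = {..<x} \<union> {x}" by auto
  then have "measure Q {..x} = measure Q {..<x} + measure Q {x}"
    by (simp only:) (rule Q.finite_measure_Union; simp)
  ultimately have lt: "measure Q {..<x} = cdf Q x" by (simp add: cdf_def)
  have compl: "measure m {x<..} = 1 - cdf m x" if "real_distribution m" for m
  proof -
    interpret m: real_distribution m by fact
    show ?thesis using m.prob_compl[of "{..x}"] by (simp add: cdf_def Compl_eq_Diff_UNIV[symmetric])
  qed
  show "(\<lambda>n. cdf (Qs n) x) \<longlonglongrightarrow> cdf Q x"
  proof (rule order_tendstoI)
    fix y assume "y < cdf Q x"
    then have "\<forall>\<^sub>F n in sequentially. y < measure (Qs n) {..<x}"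
      by (intro lim) (simp_all add: lt)
    then show "\<forall>\<^sub>F n in sequentially. y < cdf (Qs n) x"
    proof eventually_elim
      case (elim n)
      also have "measure (Qs n) {..<x} \<le> cdf (Qs n) x"
        unfolding cdf_def by (rule Qs.finite_measure_mono) auto
      finally show ?case .
    qed
  next
    fix y assume "cdf Q x < y"
    then have "\<forall>\<^sub>F n in sequentially. 1 - y < measure (Qs n) {x<..}"
      by (intro lim) (simp_all add: compl[OF Q(2)])
    then show "\<forall>\<^sub>F n in sequentially. cdf (Qs n) x < y"
      by eventually_elim (simp add: compl[OF Q(1)])
  qed
qed

text \<open>
  The push-forwards along \<open>f\<close> are distributions on the real line, so the statement is reduced
  to weak convergence there.  Compactness makes \<open>f\<close> bounded; truncating the identity at a
  bound gives a bounded test function on the line.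
\<close>

lemma portmanteau_compact:
  fixes Ps :: "nat \<Rightarrow> 'a measure" and f :: "'a \<Rightarrow> real"
  assumes X: "compact_space X"
    and Ps: "\<And>n. prob_space (Ps n)" "\<And>n. sets (Ps n) = sets (borel_of X)"
    and P: "prob_space P" "sets P = sets (borel_of X)"
    and lim: "\<And>U y. openin X U \<Longrightarrow> y < measure P U \<Longrightarrow> \<forall>\<^sub>F n in sequentially. y < measure (Ps n) U"
    and f: "continuous_map X euclideanreal f"
  shows "(\<lambda>n. \<integral>x. f x \<partial>Ps n) \<longlonglongrightarrow> (\<integral>x. f x \<partial>P)"
proof -
  have "compact (f ` topspace X)"
    using image_compactin[OF _ f] X by (simp add: compact_space_def)
  then obtain B where B: "\<And>x. x \<in> topspace X \<Longrightarrow> \<bar>f x\<bar> \<le> B"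
    using compact_imp_bounded bounded_iff by (metis imageI real_norm_def)
  define g where "g t = max (- \<bar>B\<bar>) (min \<bar>B\<bar> t)" for t :: real
  have g_cont: "isCont g t" for t unfolding g_def by (intro continuous_intros)
  have g_bound: "norm (g t) \<le> \<bar>B\<bar>" for t by (auto simp: g_def)
  have g_meas: "g \<in> borel_measurable borel"
    using g_cont by (intro borel_measurable_continuous_onI) (simp add: continuous_at_imp_continuous_on)
  have fm: "f \<in> borel_measurable m" if "sets m = sets (borel_of X)" for m
    using borel_measurable_borel_of[OF f] by (simp add: that cong: measurable_cong_sets)
  have int: "(\<integral>t. g t \<partial>distr m borel f) = (\<integral>x. f x \<partial>m)" if m: "sets m = sets (borel_of X)" for m
  proof -
    have "(\<integral>t. g t \<partial>distr m borel f) = (\<integral>x. g (f x) \<partial>m)"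
      by (rule integral_distr[OF fm[OF m] g_meas])
    also have "\<dots> = (\<integral>x. f x \<partial>m)"
    proof (rule Bochner_Integration.integral_cong)
      fix x assume "x \<in> space m"
      then have "\<bar>f x\<bar> \<le> B" using B sets_eq_imp_space_eq[OF m] by simp
      then show "g (f x) = f x" by (auto simp: g_def)
    qed simp
    finally show ?thesis .
  qed
  have open_meas: "measure (distr m borel f) S = measure m {x \<in> topspace X. f x \<in> S}"
    if "sets m = sets (borel_of X)" "open S" for m S
    using that sets_eq_imp_space_eq[OF that(1)]
    by (simp add: measure_distr fm vimage_def Int_def conj_commute)
  have rd: "real_distribution (distr m borel f)"
    if "prob_space m" "sets m = sets (borel_of X)" for m
    using prob_space.prob_space_distr[OF that(1) fm[OF that(2)]]
    by (simp add: real_distribution_def real_distribution_axioms_def)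
  have "weak_conv_m (\<lambda>n. distr (Ps n) borel f) (distr P borel f)"
  proof (rule weak_conv_m_openI[OF rd[OF Ps] rd[OF P]])
    fix S :: "real set" and y assume S: "open S" "y < measure (distr P borel f) S"
    then have "openin X {x \<in> topspace X. f x \<in> S}"
      using f by (simp add: continuous_map_def)
    from lim[OF this, of y] S
    show "\<forall>\<^sub>F n in sequentially. y < measure (distr (Ps n) borel f) S"
      by (simp add: open_meas Ps(2) P(2))
  qed
  from weak_conv_imp_integral_bdd_continuous_conv[OF rd[OF Ps] rd[OF P] this g_cont g_bound]
  show ?thesis by (simp add: int Ps(2) P(2))
qed

section \<open>Convergence in the weak* topology\<close>

lemma limitin_topology_generated_by:
  assumes "l \<in> \<Union>\<S>" and "\<And>S. S \<in> \<S> \<Longrightarrow> l \<in> S \<Longrightarrow> \<forall>\<^sub>F n in F. f n \<in> S"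
  shows "limitin (topology_generated_by \<S>) f l F"
  unfolding limitin_def topology_generated_by_topspace openin_topology_generated_by_iff
proof (intro conjI allI impI assms(1), elim conjE)
  fix U assume "generate_topology_on \<S> U" "l \<in> U"
  then show "\<forall>\<^sub>F n in F. f n \<in> U"
  proof (induction rule: generate_topology_on.induct)
    case (Int a b)
    then show ?case by (auto simp: eventually_conj_iff)
  next
    case (UN K)
    then obtain k where k: "k \<in> K" "l \<in> k" by blast
    show ?case
      by (rule eventually_mono[OF UN.IH[OF k]]) (use k(1) in blast)
  qed (use assms(2) in auto)
qed

lemma limitin_weak_star_iff:
  assumes "\<And>n. \<mu>s n \<in> compact_invariant_prob M"
  shows "limitin (weak_star_topology M) \<mu>s \<mu> sequentially \<longleftrightarrow>
    \<mu> \<in> compact_invariant_prob M \<and>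
    (\<forall>f. continuous_map (compact_topology M) euclideanreal f \<longrightarrow>
      (\<lambda>n. \<integral>x. f x \<partial>\<mu>s n) \<longlonglongrightarrow> (\<integral>x. f x \<partial>\<mu>))" (is "?L \<longleftrightarrow> ?R")
proof
  assume L: ?L
  then have \<mu>: "\<mu> \<in> compact_invariant_prob M"
    by (simp add: limitin_def topspace_weak_star)
  have "(\<lambda>n. \<integral>x. f x \<partial>\<mu>s n) \<longlonglongrightarrow> (\<integral>x. f x \<partial>\<mu>)"
    if f: "continuous_map (compact_topology M) euclideanreal f" for f
  proof (rule topological_tendstoI)
    fix S :: "real set" assume S: "open S" "(\<integral>x. f x \<partial>\<mu>) \<in> S"
    let ?N = "{\<mu> \<in> compact_invariant_prob M. (\<integral>x. f x \<partial>\<mu>) \<in> S}"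
    have "openin (weak_star_topology M) ?N"
      unfolding weak_star_topology_def openin_topology_generated_by_iff
      by (rule generate_topology_on.Basis) (use f S in blast)
    then have "\<forall>\<^sub>F n in sequentially. \<mu>s n \<in> ?N"
      using L \<mu> S(2) unfolding limitin_def by blast
    then show "\<forall>\<^sub>F n in sequentially. (\<integral>x. f x \<partial>\<mu>s n) \<in> S"
      by eventually_elim simp
  qed
  with \<mu> show ?R by blast
next
  assume R: ?R
  show ?L
    unfolding weak_star_topology_def
  proof (rule limitin_topology_generated_by)
    show "\<mu> \<in> \<Union>{{\<mu> \<in> compact_invariant_prob M. (\<integral>x. f x \<partial>\<mu>) \<in> U} | f U.
        continuous_map (compact_topology M) euclideanreal f \<and> open U}"
      using R topspace_weak_star[of M] unfolding weak_star_topology_def topology_generated_by_topspace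
      by simp
  next
    fix S assume "S \<in> {{\<mu> \<in> compact_invariant_prob M. (\<integral>x. f x \<partial>\<mu>) \<in> U} | f U.
        continuous_map (compact_topology M) euclideanreal f \<and> open U}" "\<mu> \<in> S"
    then obtain f U where S: "S = {\<mu> \<in> compact_invariant_prob M. (\<integral>x. f x \<partial>\<mu>) \<in> U}"
      "continuous_map (compact_topology M) euclideanreal f" "open U" "(\<integral>x. f x \<partial>\<mu>) \<in> U"
      by blast
    then have "\<forall>\<^sub>F n in sequentially. (\<integral>x. f x \<partial>\<mu>s n) \<in> U"
      using R topological_tendstoD by blast
    then show "\<forall>\<^sub>F n in sequentially. \<mu>s n \<in> S"
      by eventually_elim (use assms S(1) in simp)
  qed
qed

section \<open>Cylinders of the compactification\<close>

text \<open>Each finite letter is isolated: the interval contains no other value of \<open>recip\<close>.\<close>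

lemma recip_in_interval_iff:
  assumes "1 \<le> a" "1 \<le> b"
  shows "recip b \<in> {1 / (real a + 1/2)<..<1 / (real a - 1/2)} \<longleftrightarrow> b = enat a"
proof (cases b)
  case (enat n)
  then have "1 \<le> n" using assms(2) by (simp add: one_enat_def)
  then have "1 / (real a + 1/2) < 1 / real n \<longleftrightarrow> n \<le> a" "1 / real n < 1 / (real a - 1/2) \<longleftrightarrow> a \<le> n"
    using assms(1) by (auto simp: field_simps)
  then show ?thesis using enat by (auto simp: recip_def)
qed (use assms in \<open>simp add: recip_def\<close>)

lemma clopen_coordinate:
  assumes "1 \<le> a"
  shows "openin (compact_topology M) {x \<in> compactification M. x i = enat a}"
    and "closedin (compact_topology M) {x \<in> compactification M. x i = enat a}"
proof -
  let ?I = "{1 / (real a + 1/2)<..<1 / (real a - 1/2)}"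
  have ge: "1 \<le> x i" if "x \<in> compactification M" for x
    using that compactification_subset by (auto simp: ext_sequences_def)
  have "{x \<in> compactification M. x i = enat a} =
      {x \<in> topspace (compact_topology M). recip (x i) \<in> ?I}"
    unfolding topspace_compact using recip_in_interval_iff[OF assms ge] by blast
  then show "openin (compact_topology M) {x \<in> compactification M. x i = enat a}"
    using openin_continuous_map_preimage[OF continuous_map_recip, of ?I] by (simp add: open_openin[symmetric])
  have "1 \<le> enat a" using assms by (simp add: one_enat_def)
  then have "{x \<in> compactification M. x i = enat a} =
      {x \<in> topspace (compact_topology M). recip (x i) \<in> {recip (enat a)}}"
    unfolding topspace_compact using recip_inj ge by blast
  then show "closedin (compact_topology M) {x \<in> compactification M. x i = enat a}"
    using closedin_continuous_map_preimage[OF continuous_map_recip, of "{recip (enat a)}"] by simp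
qed

text \<open>
  The points of the compactification that begin with the word \<open>w\<close>; the remaining coordinates
  may be infinite.
\<close>

definition closed_cylinder :: "(nat \<Rightarrow> nat \<Rightarrow> nat) \<Rightarrow> nat list \<Rightarrow> (nat \<Rightarrow> enat) set" where
  "closed_cylinder M w = {x \<in> compactification M. \<forall>i<length w. x i = enat (w ! i)}"

lemma clopen_closed_cylinder:
  assumes "w \<noteq> []" "\<forall>a\<in>set w. 1 \<le> a"
  shows "openin (compact_topology M) (closed_cylinder M w)"
    and "closedin (compact_topology M) (closed_cylinder M w)"
proof -
  let ?S = "\<lambda>i. {x \<in> compactification M. x i = enat (w ! i)}"
  have eq: "closed_cylinder M w = (\<Inter>i\<in>{..<length w}. ?S i)"
    using assms(1) by (auto simp: closed_cylinder_def)
  have "1 \<le> w ! i" if "i < length w" for i using assms(2) that by simp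
  then show "openin (compact_topology M) (closed_cylinder M w)"
    "closedin (compact_topology M) (closed_cylinder M w)"
    unfolding eq using assms(1) clopen_coordinate
    by (auto intro!: openin_Inter closedin_Inter)
qed

lemma continuous_map_indicator_clopen:
  assumes "openin X W" "closedin X W"
  shows "continuous_map X euclideanreal (indicator W)"
  unfolding continuous_map_def
proof (intro conjI allI impI)
  fix U :: "real set"
  have W: "W \<subseteq> topspace X" using assms(1) by (rule openin_subset)
  have "{x \<in> topspace X. indicator W x \<in> U} =
      (if 1 \<in> U then W else {}) \<union> (if 0 \<in> U then topspace X - W else {})"
    using W by (auto simp: indicator_def)
  then show "openin X {x \<in> topspace X. indicator W x \<in> U}"
    using assms by (auto intro!: openin_Un simp: closedin_def)
qed auto

lemma integral_indicator_closed_cylinder: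
  assumes "w \<noteq> []" "\<forall>a\<in>set w. 1 \<le> a" "m \<in> compact_invariant_prob M"
  shows "(\<integral>x. indicat_real (closed_cylinder M w) x \<partial>m) = measure m (closed_cylinder M w)"
proof -
  interpret prob_space m using assms(3) by (simp add: compact_invariant_prob_def)
  have "closed_cylinder M w \<in> sets m"
    using openin_borel_of[OF clopen_closed_cylinder(1)[OF assms(1,2)]] assms(3)
    by (simp add: compact_invariant_prob_def)
  then show ?thesis by simp
qed

lemma incl_closed_cylinder: "{x \<in> markov_shift M. incl x \<in> closed_cylinder M w} = cylinder M w"
  using incl_in_compactification by (auto simp: closed_cylinder_def cylinder_def incl_def)

section \<open>Convergence on cylinders and weak* convergence\<close>

lemma measure_extend:
  "\<mu> \<in> invariant_prob M \<Longrightarrow> A \<in> sets (borel_of (compact_topology M)) \<Longrightarrow>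
    measure (extend_measure_to M \<mu>) A = measure \<mu> {x \<in> markov_shift M. incl x \<in> A}"
  by (simp add: measure_def emeasure_extend)

lemma weak_star_imp_cylinders:
  assumes \<mu>s: "\<And>n. \<mu>s n \<in> invariant_prob M" and \<mu>: "\<mu> \<in> invariant_prob M"
    and c: "0 \<le> c" "c \<le> 1"
    and lim: "limitin (weak_star_topology M) (\<lambda>n. extend_measure_to M (\<mu>s n))
      (mix_with_infinity M c \<mu>) sequentially"
  shows "converges_on_cylinders M \<mu>s (scale_measure (ennreal c) \<mu>)"
  unfolding converges_on_cylinders_def
proof (intro conjI allI ballI)
  show "\<mu>s n \<in> invariant_subprob M" for n by (rule invariant_prob_subprob[OF \<mu>s])
  show "scale_measure (ennreal c) \<mu> \<in> invariant_subprob M"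
    by (rule scale_in_invariant_subprob[OF \<mu> c])
  fix C assume "C \<in> cylinders M"
  then obtain w where w: "C = cylinder M w" "w \<noteq> []" "\<forall>a\<in>set w. 1 \<le> a"
    by (auto simp: cylinders_def)
  note clopen = clopen_closed_cylinder[OF w(2,3), of M]
  note meas = openin_borel_of[OF clopen(1)]
  note ext = extend_in_compact_invariant_prob[OF \<mu>s]
  have mix: "mix_with_infinity M c \<mu> \<in> compact_invariant_prob M"
    and int: "(\<lambda>n. \<integral>x. indicat_real (closed_cylinder M w) x \<partial>extend_measure_to M (\<mu>s n)) \<longlonglongrightarrow>
      (\<integral>x. indicat_real (closed_cylinder M w) x \<partial>mix_with_infinity M c \<mu>)"
    using lim[unfolded limitin_weak_star_iff[OF ext], THEN conjunct1]
      lim[unfolded limitin_weak_star_iff[OF ext], THEN conjunct2, rule_format,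
        OF continuous_map_indicator_clopen[OF clopen]] .
  have "infinity_seq \<notin> closed_cylinder M w"
    using w(2) by (auto simp: closed_cylinder_def infinity_seq_def)
  then show "(\<lambda>n. measure (\<mu>s n) C) \<longlonglongrightarrow> measure (scale_measure (ennreal c) \<mu>) C"
    using int
    unfolding integral_indicator_closed_cylinder[OF w(2,3) mix]
      integral_indicator_closed_cylinder[OF w(2,3) ext]
    by (simp add: measure_mix[OF \<mu> meas c] measure_extend[OF \<mu>s meas] incl_closed_cylinder
        measure_scale[OF c(1)] w(1))
qed

lemma cylinders_imp_weak_star:
  assumes \<mu>s: "\<And>n. \<mu>s n \<in> invariant_prob M" and \<mu>: "\<mu> \<in> invariant_prob M"
    and c: "0 \<le> c" "c < 1"
    and conv: "converges_on_cylinders M \<mu>s (scale_measure (ennreal c) \<mu>)"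
  shows "limitin (weak_star_topology M) (\<lambda>n. extend_measure_to M (\<mu>s n))
      (mix_with_infinity M c \<mu>) sequentially"
proof -
  define \<nu> where "\<nu> = scale_measure (ennreal c) \<mu>"
  have "c \<le> 1" using c(2) by simp
  interpret \<mu>: prob_space \<mu> by (rule invariant_prob_prob[OF \<mu>])
  interpret \<mu>s: prob_space "\<mu>s n" for n by (rule invariant_prob_prob[OF \<mu>s])
  have "subprob_space \<nu>"
    using scale_in_invariant_subprob[OF \<mu> c(1) \<open>c \<le> 1\<close>] by (simp add: \<nu>_def invariant_subprob_def)
  then interpret \<nu>: subprob_space \<nu> .
  have \<nu>_sets: "sets \<nu> = sets (borel_of (markov_topology M))"
    by (simp add: \<nu>_def invariant_prob_sets[OF \<mu>])
  have \<nu>_eq: "measure \<nu> A = c * measure \<mu> A" for A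
    unfolding \<nu>_def by (rule measure_scale[OF c(1)])
  note fin = \<mu>s.finite_measure_axioms invariant_prob_sets[OF \<mu>s] \<nu>.finite_measure_axioms \<nu>_sets
  have cyl: "(\<lambda>n. measure (\<mu>s n) (cylinder M w)) \<longlonglongrightarrow> measure \<nu> (cylinder M w)" if "w \<noteq> []" for w
  proof (cases "\<forall>a\<in>set w. 1 \<le> a")
    case True
    then have "cylinder M w \<in> cylinders M" using that by (auto simp: cylinders_def)
    then show ?thesis using conv by (simp add: converges_on_cylinders_def \<nu>_def)
  next
    case False
    then obtain i where "i < length w" "w ! i = 0" by (auto simp: in_set_conv_nth)
    have "x \<notin> cylinder M w" for x
    proof
      assume x: "x \<in> cylinder M w"
      have "x i = 0" using cylinder_nth[OF x \<open>i < length w\<close>] \<open>w ! i = 0\<close> by simp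
      moreover have "1 \<le> x i" using x unfolding cylinder_def markov_shift_def by blast
      ultimately show False by simp
    qed
    then have "cylinder M w = {}" by blast
    then show ?thesis by simp
  qed
  note lower = liminf_openin[OF fin cyl]
  \<comment> \<open>The complement of \<open>E N k\<close> is the trace on the Markov shift of a neighbourhood of
    \<open>infinity_seq\<close>.\<close>
  define E where "E N k = {x \<in> markov_shift M. \<exists>i<N. x i \<le> k}" for N k
  have E_Union: "E N k = \<Union> ((\<lambda>(i, a). {x \<in> markov_shift M. x i = a}) ` ({..<N} \<times> {..k}))" for N k
    by (auto simp: E_def)
  have E_open: "openin (markov_topology M) (E N k)" for N k
    unfolding E_Union by (auto intro!: openin_Union openin_coordinate)
  have E_lim: "(\<lambda>n. measure (\<mu>s n) (E N k)) \<longlonglongrightarrow> measure \<nu> (E N k)" for N k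
    unfolding E_Union
  proof (rule tendsto_measure_finite_Union[OF fin cyl])
    fix A assume "A \<in> (\<lambda>(i, a). {x \<in> markov_shift M. x i = a}) ` ({..<N} \<times> {..k})"
    then obtain i a where A: "A = {x \<in> markov_shift M. x i = a}" by auto
    then show "openin (markov_topology M) A" by (simp add: openin_coordinate)
    show "(\<lambda>n. measure (\<mu>s n) A) \<longlonglongrightarrow> measure \<nu> A"
      using cyl[of "[a]"] by (simp add: A \<nu>_eq measure_coordinate[OF \<mu>] measure_coordinate[OF \<mu>s])
  qed auto
  \<comment> \<open>Here \<open>c < 1\<close> is essential: no \<open>E N k\<close> carries the full mass in the limit.\<close>
  have inf: "infinity_seq \<in> compactification M"
  proof (rule infinity_in_compactification)
    fix N k
    have "measure \<nu> (E N k) \<le> c"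
      unfolding \<nu>_eq using c(1) by (simp add: mult_left_le)
    then have "\<forall>\<^sub>F n in sequentially. measure (\<mu>s n) (E N k) < 1"
      using c(2) by (intro order_tendstoD(2)[OF E_lim]) simp
    then obtain n where "measure (\<mu>s n) (E N k) < 1"
      using eventually_happens by fastforce
    then have "E N k \<noteq> space (\<mu>s n)"
      using \<mu>s.prob_space[of n] by auto
    then show "\<exists>y\<in>markov_shift M. \<forall>i<N. k < y i"
      unfolding invariant_prob_space[OF \<mu>s] E_def by (auto simp: not_less)
  qed
  have mix: "mix_with_infinity M c \<mu> \<in> compact_invariant_prob M"
    by (rule mix_in_compact_invariant_prob[OF \<mu> c(1) \<open>c \<le> 1\<close> inf])
  have ext: "extend_measure_to M (\<mu>s n) \<in> compact_invariant_prob M" for n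
    by (rule extend_in_compact_invariant_prob[OF \<mu>s])
  \<comment> \<open>If \<open>V\<close> contains \<open>infinity_seq\<close>, its trace \<open>U\<close> together with some \<open>E N k\<close> covers the
    Markov shift, so \<open>m U = m (markov_shift M) - m (E N k) + m (U \<inter> E N k)\<close>.  The total mass is
    \<open>1\<close> along the sequence but \<open>c\<close> in the limit, which accounts for the atom \<open>1 - c\<close>.\<close>
  have open_liminf: "\<forall>\<^sub>F n in sequentially. y < measure (extend_measure_to M (\<mu>s n)) V"
    if V: "openin (compact_topology M) V" and y: "y < measure (mix_with_infinity M c \<mu>) V" for V y
  proof -
    define U where "U = {x \<in> markov_shift M. incl x \<in> V}"
    have U: "openin (markov_topology M) U"
      unfolding U_def by (rule openin_incl_vimage[OF V])
    have y': "y < measure \<nu> U + (1 - c) * indicator V infinity_seq"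
      using y by (simp add: measure_mix[OF \<mu> openin_borel_of[OF V] c(1) \<open>c \<le> 1\<close>] U_def \<nu>_eq)
    have "\<forall>\<^sub>F n in sequentially. y < measure (\<mu>s n) U"
    proof (cases "infinity_seq \<in> V")
      case False
      then show ?thesis using y' by (intro lower U) auto
    next
      case True
      obtain N k where Nk: "\<forall>x\<in>markov_shift M. (\<forall>i<N. k < x i) \<longrightarrow> incl x \<in> V"
        using openin_infinity_tail[OF V True] by blast
      have cover: "U \<union> E N k = markov_shift M"
      proof (intro equalityI subsetI)
        fix x assume "x \<in> markov_shift M"
        then show "x \<in> U \<union> E N k"
          using Nk by (cases "\<forall>i<N. k < x i") (auto simp: U_def E_def not_less)
      qed (auto simp: U_def E_def)
      have modular: "measure m U = measure m (markov_shift M) - measure m (E N k) + measure m (U \<inter> E N k)"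
        if "finite_measure m" "sets m = sets (borel_of (markov_topology M))" for m
        using measure_modular[OF that(1), of U "E N k"] that(2) openin_borel_of[OF U]
          openin_borel_of[OF E_open] by (simp add: cover)
      have total: "measure (\<mu>s n) (markov_shift M) = 1" "measure \<nu> (markov_shift M) = c" for n
        using \<mu>s.prob_space[of n] \<mu>.prob_space
        by (simp_all add: invariant_prob_space[OF \<mu>] invariant_prob_space[OF \<mu>s] \<nu>_eq)
      define d where "d = (measure \<nu> U + (1 - c) - y) / 2"
      have d: "d > 0" using y' True by (simp add: d_def)
      have "\<forall>\<^sub>F n in sequentially. measure \<nu> (U \<inter> E N k) - d < measure (\<mu>s n) (U \<inter> E N k)"
        using d by (intro lower openin_Int U E_open) auto
      moreover have "\<forall>\<^sub>F n in sequentially. measure (\<mu>s n) (E N k) < measure \<nu> (E N k) + d"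
        using d by (intro order_tendstoD(2)[OF E_lim]) auto
      ultimately show ?thesis
      proof eventually_elim
        case (elim n)
        have "y = measure \<nu> U + (1 - c) - 2 * d" by (simp add: d_def field_simps)
        then show ?case
          using elim modular[OF fin(1,2), of n] modular[OF fin(3,4)] total(1)[of n] total(2) by linarith
      qed
    qed
    then show ?thesis
      by (simp add: measure_extend[OF \<mu>s openin_borel_of[OF V]] U_def)
  qed
  have prob: "prob_space (mix_with_infinity M c \<mu>)"
    using mix by (simp add: compact_invariant_prob_def)
  show ?thesis
    unfolding limitin_weak_star_iff[OF ext]
    by (intro conjI allI impI mix)
      (rule portmanteau_compact[OF compact_space_compact_topology prob_space_extend[OF \<mu>s]
        sets_extend prob sets_mix open_liminf])
qed

theorem theorem3p5:
  fixes M :: "nat \<Rightarrow> nat \<Rightarrow> nat"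
    and \<mu>s :: "nat \<Rightarrow> (nat \<Rightarrow> nat) measure"
    and \<mu> :: "(nat \<Rightarrow> nat) measure"
  assumes "transition_matrix M"
    and "transitive_shift M"
    and "\<And>n. \<mu>s n \<in> invariant_prob M"
    and "\<mu> \<in> invariant_prob M"
  shows
    "(\<forall>c::real. 0 \<le> c \<and> c < 1 \<and>
        converges_on_cylinders M \<mu>s (scale_measure (ennreal c) \<mu>) \<longrightarrow>
        limitin (weak_star_topology M) (\<lambda>n. extend_measure_to M (\<mu>s n))
          (mix_with_infinity M c \<mu>) sequentially) \<and>
     (\<forall>c::real. 0 \<le> c \<and> c \<le> 1 \<and> infinity_seq \<in> compactification M \<and>
        limitin (weak_star_topology M) (\<lambda>n. extend_measure_to M (\<mu>s n))
          (mix_with_infinity M c \<mu>) sequentially \<longrightarrow>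
        converges_on_cylinders M \<mu>s (scale_measure (ennreal c) \<mu>))"
proof (intro conjI allI impI; elim conjE)
  fix c :: real
  assume "0 \<le> c" "c < 1" "converges_on_cylinders M \<mu>s (scale_measure (ennreal c) \<mu>)"
  then show "limitin (weak_star_topology M) (\<lambda>n. extend_measure_to M (\<mu>s n))
      (mix_with_infinity M c \<mu>) sequentially"
    by (rule cylinders_imp_weak_star[OF assms(3,4)])
next
  fix c :: real
  assume "0 \<le> c" "c \<le> 1" "limitin (weak_star_topology M) (\<lambda>n. extend_measure_to M (\<mu>s n))
      (mix_with_infinity M c \<mu>) sequentially"
  then show "converges_on_cylinders M \<mu>s (scale_measure (ennreal c) \<mu>)"
    by (rule weak_star_imp_cylinders[OF assms(3,4)])
qed

end
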